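(* The following holds for a large enough universal constant $C$. Suppose that $\zeta=\zeta_N$ satisfies $1\ll\zeta\le\frac{d}{C\log\log N}$, and write $d=b\log N$. (i) For $2\le\alpha<\beta\le\alpha_{\max}(b)$ satisfying $\beta-\alpha\ge C\frac{\zeta\log\log N}{d\log\alpha}$, with high probability $$|\{x\in[N]:\alpha\le\alpha_x\le\beta\}|=N^{\theta_b(\alpha)+\epsilon},\qquad\epsilon=O\left(\frac{\zeta\log\log N}{\log N}\right).$$ (ii) For $\delta\ge C\frac{\zeta\log\log N}{d}$ and $2+\delta\le\lambda\le\Lambda(\alpha_{\max}(b))$, with high probability $$|\mathcal W_{\lambda,\delta}|=N^{\theta_b(\Lambda^{-1}(\lambda-\delta))+\epsilon},\qquad\epsilon=O\left(\frac{\zeta\log\log N}{\log N}\right).$$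
   Context: $A$ is the adjacency matrix of the Erdős–Rényi random graph $\mathbb G(N,d/N)$ on $[N]=\{1,\dots,N\}$ with edge probability $d/N$ (edges present independently), and $\alpha_x=\frac1d\sum_{y\in[N]}A_{xy}$. All quantities ($d,b,\zeta,\alpha,\beta,\lambda,\delta$) may depend on $N$; $X\ll Y$ means $X/Y\to0$ as $N\to\infty$; $X=O(Y)$ means $|X|\le C'Y$ for a universal constant $C'$. An event holds with high probability if its probability is $1-o(1)$ as $N\to\infty$. $\Lambda:[2,\infty)\to[2,\infty)$, $\Lambda(\alpha)=\frac{\alpha}{\sqrt{\alpha-1}}$, is bijective. For $b\ge0$ and $\alpha\ge2$, $\theta_b(\alpha)=[1-b(\alpha\log\alpha-\alpha+1)]_+$, and $\alpha_{\max}(b)=\inf\{\alpha\ge2:\theta_b(\alpha)=0\}$. $\mathcal W_{\lambda,\delta}=\{x\in[N]:\alpha_x\ge2,\ |\Lambda(\alpha_x)-\lambda|\le\delta\}$. *)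

theory Defs
  imports "HOL-Probability.Probability" "HOL-Probability.Product_PMF"
begin

definition vertex_pairs :: "nat \<Rightarrow> nat set set" where
  "vertex_pairs N = {e. e \<subseteq> {1..N} \<and> card e = 2}"

text \<open>The Erdos-Renyi graph on the vertex set \<open>{1..N}\<close> with edge probability \<open>p\<close>, as the
  distribution of its edge set. Only \<open>0 \<le> p \<le> 1\<close> is meaningful, since the library clips the
  parameter of a Bernoulli distribution to this interval.\<close>

definition erdos_renyi :: "nat \<Rightarrow> real \<Rightarrow> nat set set pmf" where
  "erdos_renyi N p =
     map_pmf (\<lambda>\<omega>. {e \<in> vertex_pairs N. \<omega> e})
       (Pi_pmf (vertex_pairs N) False (\<lambda>_. bernoulli_pmf p))"

definition adj :: "nat set set \<Rightarrow> nat \<Rightarrow> nat \<Rightarrow> real" where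
  "adj E x y = of_bool ({x, y} \<in> E)"

definition norm_degree :: "nat \<Rightarrow> real \<Rightarrow> nat set set \<Rightarrow> nat \<Rightarrow> real" where
  "norm_degree N d E x = (1 / d) * (\<Sum>y\<in>{1..N}. adj E x y)"

definition \<Lambda> :: "real \<Rightarrow> real" where
  "\<Lambda> \<alpha> = \<alpha> / sqrt (\<alpha> - 1)"

text \<open>\<open>\<Lambda>\<close> maps \<open>{2..}\<close> bijectively onto itself; \<open>\<Lambda>_inv\<close> is only meaningful on that set.\<close>

definition \<Lambda>_inv :: "real \<Rightarrow> real" where
  "\<Lambda>_inv = inv_into {2..} \<Lambda>"

definition \<theta> :: "real \<Rightarrow> real \<Rightarrow> real" where
  "\<theta> b \<alpha> = max 0 (1 - b * (\<alpha> * ln \<alpha> - \<alpha> + 1))"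

text \<open>For \<open>b > 0\<close> the set below is nonempty and bounded below. For \<open>b = 0\<close> it is empty and the
  real-valued \<open>Inf\<close> does not represent the infimum \<open>\<infinity>\<close>.\<close>

definition \<alpha>_max :: "real \<Rightarrow> real" where
  "\<alpha>_max b = Inf {\<alpha>. \<alpha> \<ge> 2 \<and> \<theta> b \<alpha> = 0}"

definition \<W> :: "nat \<Rightarrow> real \<Rightarrow> nat set set \<Rightarrow> real \<Rightarrow> real \<Rightarrow> nat set" where
  "\<W> N d E l \<delta> =
     {x \<in> {1..N}. norm_degree N d E x \<ge> 2 \<and> \<bar>\<Lambda> (norm_degree N d E x) - l\<bar> \<le> \<delta>}"

definition whp :: "(nat \<Rightarrow> 'a pmf) \<Rightarrow> (nat \<Rightarrow> 'a \<Rightarrow> bool) \<Rightarrow> bool" where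
  "whp G P \<longleftrightarrow> (\<lambda>N. measure_pmf.prob (G N) {\<omega>. P N \<omega>}) \<longlonglongrightarrow> 1"

end

theory Submission
  imports Defs "HOL-Analysis.Harmonic_Numbers" "HOL-Real_Asymp.Real_Asymp"
begin

text \<open>
  Write \<open>L = ln N\<close> and \<open>rate a = a * ln a - a + 1\<close>. The degree of a vertex is binomial with mean close
  to \<open>d\<close>, hence close to Poisson, and exceeds \<open>d * \<alpha>\<close> with probability about
  \<open>exp (- d * rate \<alpha>) = N powr (- b * rate \<alpha>)\<close>. So about \<open>N powr (1 - b * rate \<alpha>) = N powr \<theta> b \<alpha>\<close>
  vertices have normalised degree at least \<open>\<alpha>\<close>. The allowed error in the exponent amounts to a
  factor \<open>L powr \<zeta>\<close> in the count, and as \<open>\<zeta>\<close> tends to infinity it absorbs every fixed power of \<open>L\<close>;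
  this is why \<open>C\<^sub>0 = K = 1\<close> is possible.

  The upper bound is a first moment computation: the Chernoff bound for the binomial distribution
  (\<open>binomial_Chernoff\<close>) and Markov's inequality (\<open>prob_many_vertices_of_large_degree\<close>).

  For the lower bound it suffices to count the vertices whose degree is exactly
  \<open>k = \<lceil>d * \<alpha>\<rceil>\<close>. All relevant degrees are \<open>O(L)\<close>, so Stirling's formula bounds the probability of this
  degree from below by \<open>exp (- d * rate \<alpha>)\<close> up to a power of \<open>L\<close> (\<open>binomial_pmf_ge_rate\<close>). The gap
  between \<open>\<alpha>\<close> and \<open>\<beta> \<le> \<alpha>_max b\<close> forces \<open>N powr \<theta> b \<alpha>\<close> to be at least \<open>L powr (\<zeta> / 2)\<close>, so the expected
  number of these vertices tends to infinity. The degrees of two vertices are coupled only by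
  the edge that may join them, which makes the covariances negligible
  (\<open>binomial_pmf_second_moment\<close>), and Chebyshev's inequality shows that at least half of the
  expected number occurs (\<open>prob_few_vertices_of_degree\<close>).

  The second part reduces to the same estimate because \<open>\<Lambda>\<close> is increasing on \<open>{2..}\<close>: the set \<open>\<W>\<close> lies
  between the vertices with normalised degree in \<open>[\<Lambda>_inv (l - \<delta>), \<Lambda>_inv l]\<close> and those with normalised
  degree at least \<open>\<Lambda>_inv (l - \<delta>)\<close>. As \<open>\<Lambda>\<close> has slope at most \<open>1 / 2\<close>, that interval has length at least
  \<open>2 * \<delta>\<close>, which is the required gap.
\<close>

section \<open>The rate function and binomial probabilities\<close>

text \<open>The large-deviation rate of a Poisson variable: \<open>d * rate a\<close> is the exponential cost for a
  Poisson variable of mean \<open>d\<close> to take the value \<open>d * a\<close>. With \<open>d = b * ln N\<close> it turns a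
  probability into the power \<open>- b * rate a\<close> of \<open>N\<close>, and \<open>\<theta> b a\<close> is the positive part of
  \<open>1 - b * rate a\<close>.\<close>

definition rate :: "real \<Rightarrow> real" where
  "rate a = a * ln a - a + 1"

text \<open>Convexity, in the form of the tangent line at \<open>x\<close>: the derivative of \<open>rate\<close> is \<open>ln\<close>. Taking
  the tangent at the smaller point bounds the growth of the rate from below, taking it at the
  larger point bounds it from above.\<close>

lemma rate_tangent:
  assumes "x > 0" "y > 0"
  shows "rate x + ln x * (y - x) \<le> rate y"
proof -
  have "ln (x / y) \<le> x / y - 1"
    using assms by (intro ln_le_minus_one) simp
  then have "y * (ln x - ln y) \<le> y * (x / y - 1)"
    using assms by (simp add: ln_div)
  also have "\<dots> = x - y"
    using assms by (simp add: field_simps)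
  finally show ?thesis
    by (simp add: rate_def algebra_simps)
qed

text \<open>The tangent at \<open>2\<close>. It keeps every density \<open>t\<close> below the maximal one of size \<open>O(1 / b)\<close>, so that
  all degrees that matter are \<open>O(ln N)\<close>.\<close>

lemma rate_ge_linear:
  assumes "t \<ge> 2"
  shows "t / 6 \<le> rate t"
proof -
  have "rate 2 + ln 2 * (t - 2) \<le> rate t"
    using assms by (intro rate_tangent) auto
  moreover have "rate 2 + ln 2 * (t - 2) = ln 2 * t - 1"
    by (simp add: rate_def algebra_simps)
  moreover have "(2/3) * t \<le> ln 2 * t"
    using assms ln2_ge_two_thirds by (intro mult_right_mono) auto
  ultimately show ?thesis
    using assms by linarith
qed

text \<open>A crude Stirling bound: an extra factor \<open>sqrt k\<close> is harmless because \<open>k\<close> is of order \<open>ln N\<close>, while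
  the exponential factor must be exact. The induction step is
  \<open>exp 1 \<le> (1 + 1 / k) ^ Suc k\<close>.\<close>

lemma fact_le_Stirling:
  assumes "k \<ge> 1"
  shows "fact k \<le> exp 1 * real k * (real k / exp 1) ^ k"
  using assms
proof (induction k rule: dec_induct)
  case base
  show ?case by simp
next
  case (step k)
  have k: "real k > 0" using step by simp
  have "- ln (1 + 1 / real k) = ln (real k / (real k + 1))"
    using k by (simp add: ln_div add_divide_eq_iff)
  also have "\<dots> \<le> real k / (real k + 1) - 1"
    using k by (intro ln_le_minus_one) simp
  also have "\<dots> = - 1 / (real k + 1)"
    using k by (simp add: field_simps)
  finally have "(real k + 1) * (1 / (real k + 1)) \<le> (real k + 1) * ln (1 + 1 / real k)"
    using k by (intro mult_left_mono) auto
  then have "exp 1 \<le> exp (real (Suc k) * ln (1 + 1 / real k))"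
    using k by (simp add: add.commute)
  also have "\<dots> = (1 + 1 / real k) ^ Suc k"
    using k by (simp only: exp_of_nat_mult) (simp add: add_pos_pos)
  finally have e: "exp 1 \<le> (1 + 1 / real k) ^ Suc k" .
  have "fact (Suc k) \<le> (real k + 1) * (exp 1 * real k * (real k / exp 1) ^ k)"
    using step.IH by (simp add: add.commute mult_left_mono)
  also have "\<dots> = (real k + 1) * (exp 1 * exp 1 * (real k / exp 1) ^ Suc k)"
    by simp
  also have "\<dots> \<le> (real k + 1) * (exp 1 * (1 + 1 / real k) ^ Suc k * (real k / exp 1) ^ Suc k)"
    using e k by (intro mult_left_mono mult_right_mono) auto
  also have "(1 + 1 / real k) ^ Suc k * (real k / exp 1) ^ Suc k = ((real k + 1) / exp 1) ^ Suc k"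
  proof -
    have "(1 + 1 / real k) * (real k / exp 1) = (real k + 1) / exp 1"
      using k by (simp add: field_simps)
    then show ?thesis by (metis power_mult_distrib)
  qed
  then have "(real k + 1) * (exp 1 * (1 + 1 / real k) ^ Suc k * (real k / exp 1) ^ Suc k)
      = exp 1 * real (Suc k) * (real (Suc k) / exp 1) ^ Suc k"
    by (metis (no_types, opaque_lifting) mult.assoc mult.commute of_nat_Suc add.commute)
  finally show ?case .
qed

lemma binomial_Suc_ratio:
  assumes "k < n"
  shows "real (Suc k) * real (n choose Suc k) = (real n - real k) * real (n choose k)"
proof -
  have "Suc k * (n choose Suc k) = (n - k) * (n choose k)"
    by (metis Suc_times_binomial_eq binomial_absorb_comp mult.commute binomial_absorption)
  then have "real (Suc k * (n choose Suc k)) = real ((n - k) * (n choose k))" by presburger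
  then show ?thesis using assms by (simp only: of_nat_mult of_nat_diff less_imp_le)
qed

lemma power_le_binomial_fact:
  assumes "k \<le> n"
  shows "(real n - real k) ^ k \<le> real (n choose k) * fact k"
  using assms
proof (induction k)
  case (Suc k)
  have "(real n - real (Suc k)) ^ Suc k \<le> (real n - real k) ^ Suc k"
    using Suc.prems by (intro power_mono) auto
  also have "\<dots> \<le> (real n - real k) * (real (n choose k) * fact k)"
    using Suc by (simp add: mult_left_mono)
  also have "\<dots> = real (Suc k) * real (n choose Suc k) * fact k"
    using binomial_Suc_ratio[of k n] Suc.prems by (simp add: mult.assoc)
  finally show ?case by (simp add: algebra_simps)
qed simp

text \<open>When \<open>k\<close> and \<open>d\<close> are small compared to \<open>sqrt N\<close>, the falling factorial in the binomial
  coefficient is comparable to \<open>N ^ k\<close>, and \<open>(1 - d / N) ^ N\<close> is comparable to \<open>exp (- d)\<close>; the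
  binomial weight is thus at least a constant times the Poisson weight.\<close>

lemma binomial_pmf_ge_Poisson:
  fixes d :: real
  assumes d: "d > 0" and k: "2 * k * (k + 1) \<le> N" "k \<ge> 1" and dN: "2 * d\<^sup>2 \<le> real N"
  shows "exp (- d - 1) / 2 * (d ^ k / fact k) \<le> pmf (binomial_pmf (N - 1) (d / N)) k"
proof -
  define p where "p = d / real N"
  have "4 \<le> 2 * k * (k + 1)" using k(2) mult_le_mono[of 2 "2*k" 2 "k+1"] by simp
  then have N: "real N \<ge> 4" using k(1) by linarith
  have "2 * d \<le> real N"
  proof (rule ccontr)
    assume "\<not> 2 * d \<le> real N"
    then have "real N * real N < (2 * d) * (2 * d)" using N by (intro mult_strict_mono) auto
    then have "real N * real N < 2 * real N"
      using dN by (simp add: power2_eq_square)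
    then show False using N by simp
  qed
  then have p: "0 < p" "p \<le> 1/2" using d N by (auto simp: p_def field_simps)
  have kk: "2 * (real k * (real k + 1)) \<le> real N"
    using k(1) by (metis (no_types) mult.assoc of_nat_1 of_nat_add of_nat_le_iff of_nat_mult of_nat_numeral)
  have "real k + 1 \<le> real k * (real k + 1)" using k(2) by simp
  then have kN: "real k + 1 \<le> real N" using kk N by linarith
  have "exp (- d - 1) \<le> exp (real N * (- p - 2 * p\<^sup>2))"
  proof -
    have "2 * d\<^sup>2 / real N \<le> 1" using dN N by simp
    moreover have "real N * (- p - 2 * p\<^sup>2) = - d - 2 * d\<^sup>2 / real N"
      using N by (simp add: p_def field_simps power2_eq_square)
    ultimately show ?thesis by simp
  qed
  also have "\<dots> \<le> exp (real N * ln (1 - p))"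
    using p ln_one_minus_pos_lower_bound[of p] by (simp add: mult_left_mono)
  also have "\<dots> = (1 - p) ^ N" using p by (simp add: exp_of_nat_mult)
  also have "\<dots> \<le> (1 - p) ^ (N - 1 - k)" using p by (intro power_decreasing) auto
  finally have 1: "exp (- d - 1) \<le> (1 - p) ^ (N - 1 - k)" .
  have "1 / 2 \<le> 1 + real k * (- ((real k + 1) / real N))"
    using kk N by (simp add: field_simps)
  also have "\<dots> \<le> (1 + - ((real k + 1) / real N)) ^ k"
    using kN N by (intro Bernoulli_inequality) (simp add: field_simps)
  finally have 2: "1 / 2 \<le> ((real N - 1 - real k) / real N) ^ k"
    using N by (simp add: field_simps)
  have "(real (N - 1) - real k) ^ k \<le> real ((N - 1) choose k) * fact k"
    using kN by (intro power_le_binomial_fact) linarith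
  then have 3: "(real N - 1 - real k) ^ k / fact k \<le> real ((N - 1) choose k)"
    using N by (simp add: of_nat_diff field_simps)
  have "1 / 2 * (d ^ k / fact k)
      \<le> ((real N - 1 - real k) / real N) ^ k * (d ^ k / fact k)"
    using 2 d by (intro mult_right_mono) auto
  also have "\<dots> = (real N - 1 - real k) ^ k / fact k * p ^ k"
    by (simp add: p_def power_divide)
  also have "\<dots> \<le> real ((N - 1) choose k) * p ^ k"
    using 3 p by (intro mult_right_mono) auto
  finally have "1 / 2 * (d ^ k / fact k) * exp (- d - 1)
      \<le> real ((N - 1) choose k) * p ^ k * (1 - p) ^ (N - 1 - k)"
    by (rule mult_mono [OF _ 1]) (use p in simp_all)
  also have "\<dots> = pmf (binomial_pmf (N - 1) p) k" using p by simp
  finally show ?thesis unfolding p_def by (simp add: mult_ac)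
qed

lemma binomial_pmf_ge_rate:
  fixes d :: real
  assumes d: "d > 0" and k: "2 * k * (k + 1) \<le> N" "k \<ge> 1" and dN: "2 * d\<^sup>2 \<le> real N"
  shows "exp (- d * rate (k / d)) / (16 * real k) \<le> pmf (binomial_pmf (N - 1) (d / N)) k"
proof -
  have k0: "real k > 0" using k by simp
  have e: "(exp 1 :: real) * exp 1 \<le> 8"
  proof -
    have "(exp 1 :: real) * exp 1 \<le> 2.8 * 2.8" 
      using e_less_272 by (intro mult_mono) auto
    then show ?thesis by simp
  qed
  have "exp (- d * rate (k / d)) = exp (- d + real k + real k * (ln d - ln (real k)))"
    using d k0 by (simp add: rate_def ln_div field_simps)
  also have "\<dots> = exp (- d) * exp (real k * (1 + ln d - ln (real k)))"
    by (simp add: exp_add [symmetric] algebra_simps)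
  also have "exp (real k * (1 + ln d - ln (real k))) = (d * exp 1 / real k) ^ k"
    using d k0 by (simp only: exp_of_nat_mult) (simp add: exp_add exp_diff mult_ac)
  finally have 1: "exp (- d * rate (k / d)) = exp (- d) * (d * exp 1 / real k) ^ k" .
  have "d ^ k / (exp 1 * real k * (real k / exp 1) ^ k) \<le> d ^ k / fact k"
    using fact_le_Stirling[OF k(2)] d k0 by (intro divide_left_mono mult_pos_pos) auto
  moreover have "d ^ k / (exp 1 * real k * (real k / exp 1) ^ k) = (d * exp 1 / real k) ^ k / (exp 1 * real k)"
    using k0 by (simp add: power_divide power_mult_distrib field_simps)
  ultimately have 2: "(d * exp 1 / real k) ^ k / (exp 1 * real k) \<le> d ^ k / fact k" by simp
  have "exp (- d * rate (k / d)) / (16 * real k) \<le> exp (- d * rate (k / d)) / (2 * (exp 1 * exp 1) * real k)"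
    using e k0 by (intro divide_left_mono mult_right_mono) auto
  also have "\<dots> = exp (- d - 1) / 2 * ((d * exp 1 / real k) ^ k / (exp 1 * real k))"
    unfolding 1 by (simp add: exp_diff)
  also have "\<dots> \<le> exp (- d - 1) / 2 * (d ^ k / fact k)"
    using 2 by (intro mult_left_mono) auto
  also note binomial_pmf_ge_Poisson[OF assms]
  finally show ?thesis .
qed

text \<open>The exponential Markov inequality with \<open>exp s = a\<close>, the optimal choice in the Poisson case. The
  generating function of the binomial distribution is dominated by that of the Poisson one.\<close>

lemma binomial_Chernoff:
  fixes p a :: real
  assumes p: "p \<in> {0..1}" and a: "a \<ge> 1" and n: "real n * p \<le> d"
  shows "measure_pmf.prob (binomial_pmf n p) {k. d * a \<le> real k} \<le> exp (- d * rate a)"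
proof -
  let ?B = "binomial_pmf n p"
  have "measure_pmf.prob ?B {k. d * a \<le> real k}
      = measure_pmf.expectation ?B (indicator {k. d * a \<le> real k})" by simp
  also have "\<dots> \<le> measure_pmf.expectation ?B (\<lambda>k. a ^ k * exp (- d * a * ln a))"
  proof (rule integral_mono)
    fix k :: nat
    show "indicator {k. d * a \<le> real k} k \<le> a ^ k * exp (- d * a * ln a)"
    proof (cases "d * a \<le> real k")
      case True
      have "0 \<le> (real k - d * a) * ln a" using True a by simp
      then have "1 \<le> exp (real k * ln a) * exp (- d * a * ln a)"
        by (simp add: exp_add [symmetric] algebra_simps)
      also have "exp (real k * ln a) = a ^ k" using a by (simp add: exp_of_nat_mult)
      finally show ?thesis using True by simp
    qed (use a in simp)
  qed (use p in auto)
  also have "\<dots> = (p * a + (1 - p)) ^ n * exp (- d * a * ln a)"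
    by (subst expectation_binomial_pmf'[OF p], subst binomial_ring)
       (simp add: sum_distrib_right sum_distrib_left power_mult_distrib mult_ac)
  also have "\<dots> \<le> exp (p * (a - 1)) ^ n * exp (- d * a * ln a)"
  proof (intro mult_right_mono power_mono)
    show "p * a + (1 - p) \<le> exp (p * (a - 1))"
      using exp_ge_add_one_self[of "p * (a - 1)"] by (simp add: algebra_simps)
  qed (use p a in auto)
  also have "\<dots> = exp ((real n * p) * (a - 1) - d * a * ln a)"
    by (simp add: exp_of_nat_mult [symmetric] exp_add [symmetric] mult_ac)
  also have "\<dots> \<le> exp (d * (a - 1) - d * a * ln a)"
    using n a by (simp add: mult_right_mono)
  finally show ?thesis by (simp add: rate_def algebra_simps)
qed

section \<open>Degrees in the random graph\<close>

definition random_subset :: "'a set \<Rightarrow> real \<Rightarrow> 'a set pmf" where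
  "random_subset I p = map_pmf (\<lambda>\<omega>. {e \<in> I. \<omega> e}) (Pi_pmf I False (\<lambda>_. bernoulli_pmf p))"

text \<open>The single source of independence: traces of the random set on disjoint sets of edges are
  independent, and each is again a random subset with the same inclusion probability.\<close>

lemma random_subset_Int_indep:
  assumes "finite I" "A \<subseteq> I" "B \<subseteq> I" "A \<inter> B = {}"
  shows "map_pmf (\<lambda>E. (E \<inter> A, E \<inter> B)) (random_subset I p)
    = pair_pmf (random_subset A p) (random_subset B p)"
proof -
  let ?Pi = "\<lambda>S. Pi_pmf S False (\<lambda>_. bernoulli_pmf p)"
  have fin: "finite A" "finite B" using assms by (auto intro: finite_subset)
  have "map_pmf (\<lambda>E. (E \<inter> A, E \<inter> B)) (random_subset I p)
      = map_pmf (\<lambda>\<omega>. ({e \<in> A. \<omega> e}, {e \<in> B. \<omega> e})) (?Pi I)"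
    unfolding random_subset_def pmf.map_comp
    by (intro map_pmf_cong refl) (use assms in \<open>auto simp: o_def\<close>)
  also have "\<dots> = map_pmf (\<lambda>\<omega>. ({e \<in> A. \<omega> e}, {e \<in> B. \<omega> e})) (?Pi (A \<union> B))"
    using assms by (subst Pi_pmf_subset [of I "A \<union> B"])
      (auto simp: pmf.map_comp o_def intro!: map_pmf_cong)
  also have "\<dots> = map_pmf (\<lambda>(f, g). ({e \<in> A. f e}, {e \<in> B. g e})) (pair_pmf (?Pi A) (?Pi B))"
    using assms(4) by (subst Pi_pmf_union [OF fin assms(4)])
      (auto simp: pmf.map_comp o_def case_prod_unfold intro!: map_pmf_cong)
  also have "\<dots> = pair_pmf (random_subset A p) (random_subset B p)"
    unfolding random_subset_def by (rule map_pair)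
  finally show ?thesis .
qed

lemma random_subset_Int:
  assumes "finite I" "A \<subseteq> I"
  shows "map_pmf (\<lambda>E. E \<inter> A) (random_subset I p) = random_subset A p"
proof -
  have "map_pmf (\<lambda>E. E \<inter> A) (random_subset I p)
      = map_pmf fst (map_pmf (\<lambda>E. (E \<inter> A, E \<inter> {})) (random_subset I p))"
    by (simp add: pmf.map_comp o_def)
  also have "\<dots> = random_subset A p"
    using assms by (subst random_subset_Int_indep) (auto simp: map_fst_pair_pmf)
  finally show ?thesis .
qed

lemma card_random_subset:
  assumes "finite A" "p \<in> {0..1}"
  shows "map_pmf card (random_subset A p) = binomial_pmf (card A) p"
  using binomial_pmf_altdef' [OF assms(1) refl assms(2), of False]
  by (simp add: random_subset_def pmf.map_comp o_def)

text \<open>The event on \<open>A\<close> is arbitrary whereas only the cardinality is observed on \<open>B\<close>. The asymmetry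
  allows the lemma to be applied twice in order to separate three disjoint sets.\<close>

lemma prob_random_subset_indep:
  assumes "finite I" "A \<subseteq> I" "B \<subseteq> I" "A \<inter> B = {}" "p \<in> {0..1}"
  shows "measure_pmf.prob (random_subset I p) {E. P (E \<inter> A) \<and> Q (card (E \<inter> B))}
    = measure_pmf.prob (random_subset A p) {E. P E} * measure_pmf.prob (binomial_pmf (card B) p) {k. Q k}"
proof -
  have fin: "finite A" "finite B" using assms by (auto intro: finite_subset)
  have "measure_pmf.prob (random_subset I p) {E. P (E \<inter> A) \<and> Q (card (E \<inter> B))}
     = measure_pmf.prob (map_pmf (\<lambda>E. (E \<inter> A, E \<inter> B)) (random_subset I p)) ({E. P E} \<times> {E. Q (card E)})"
    by (simp add: vimage_def)
  also have "\<dots> = measure_pmf.prob (random_subset A p) {E. P E} * measure_pmf.prob (random_subset B p) {E. Q (card E)}"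
  proof -
    have "measure_pmf.prob (pair_pmf M R) (X \<times> Y) = measure_pmf.prob M X * measure_pmf.prob R Y"
      for M R :: "'a set pmf" and X Y
    proof -
      have "measure_pmf.prob (pair_pmf M R) (X \<times> Y) = measure_pmf.prob (pair_pmf M R) ((X \<inter> set_pmf M) \<times> (Y \<inter> set_pmf R))"
        by (subst measure_Int_set_pmf [symmetric]) (auto intro!: arg_cong[where f = "measure _"])
      also have "\<dots> = measure_pmf.prob M X * measure_pmf.prob R Y"
        by (subst measure_pmf_prob_product) (auto simp: measure_Int_set_pmf)
      finally show ?thesis .
    qed
    then show ?thesis using assms by (simp add: random_subset_Int_indep)
  qed
  also have "measure_pmf.prob (random_subset B p) {E. Q (card E)}
      = measure_pmf.prob (map_pmf card (random_subset B p)) {k. Q k}"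
    by (simp add: vimage_def)
  also have "map_pmf card (random_subset B p) = binomial_pmf (card B) p"
    using fin assms by (simp add: card_random_subset)
  finally show ?thesis .
qed

definition star :: "nat \<Rightarrow> nat \<Rightarrow> nat set set" where
  "star N x = (\<lambda>y. {x, y}) ` ({1..N} - {x})"

definition vertex_degree :: "nat \<Rightarrow> nat set set \<Rightarrow> nat \<Rightarrow> nat" where
  "vertex_degree N E x = card (E \<inter> star N x)"

lemma finite_vertex_pairs: "finite (vertex_pairs N)"
  by (rule finite_subset[of _ "Pow {1..N}"]) (auto simp: vertex_pairs_def)

lemma star_subset: "x \<in> {1..N} \<Longrightarrow> star N x \<subseteq> vertex_pairs N"
  by (auto simp: star_def vertex_pairs_def)

lemma card_star:
  assumes "x \<in> {1..N}"
  shows "card (star N x) = N - 1"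
proof -
  have "inj_on (\<lambda>y. {x, y}) ({1..N} - {x})"
    by (auto simp: inj_on_def doubleton_eq_iff)
  then show ?thesis using assms by (simp add: star_def card_image)
qed

lemma star_Int_star:
  assumes "x \<in> {1..N}" "y \<in> {1..N}" "x \<noteq> y"
  shows "star N x \<inter> star N y = {{x, y}}"
  using assms by (auto simp: star_def doubleton_eq_iff)

lemma erdos_renyi_eq_random_subset: "erdos_renyi N p = random_subset (vertex_pairs N) p"
  by (simp add: erdos_renyi_def random_subset_def)

lemma set_erdos_renyi: "E \<in> set_pmf (erdos_renyi N p) \<Longrightarrow> E \<subseteq> vertex_pairs N"
  by (auto simp: erdos_renyi_def)

lemma norm_degree_eq:
  assumes "E \<subseteq> vertex_pairs N"
  shows "norm_degree N d E x = real (vertex_degree N E x) / d"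
proof -
  have "(\<Sum>y\<in>{1..N}. adj E x y) = real (card {y \<in> {1..N}. {x, y} \<in> E})"
    by (simp add: adj_def sum_of_bool_eq Int_def)
  also have "card {y \<in> {1..N}. {x, y} \<in> E} = card ((\<lambda>y. {x, y}) ` {y \<in> {1..N}. {x, y} \<in> E})"
    by (intro card_image [symmetric]) (auto simp: inj_on_def doubleton_eq_iff)
  also have "(\<lambda>y. {x, y}) ` {y \<in> {1..N}. {x, y} \<in> E} = E \<inter> star N x"
  proof -
    have "x \<noteq> y" if "{x, y} \<in> E" for y
      using that assms by (auto simp: vertex_pairs_def)
    then show ?thesis using assms by (auto simp: star_def vertex_pairs_def)
  qed
  finally show ?thesis by (simp add: norm_degree_def vertex_degree_def)
qed

lemma degree_binomial:
  assumes "x \<in> {1..N}" "p \<in> {0..1}"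
  shows "map_pmf (\<lambda>E. vertex_degree N E x) (erdos_renyi N p) = binomial_pmf (N - 1) p"
proof -
  have "map_pmf (\<lambda>E. vertex_degree N E x) (erdos_renyi N p)
      = map_pmf card (map_pmf (\<lambda>E. E \<inter> star N x) (erdos_renyi N p))"
    by (simp add: pmf.map_comp o_def vertex_degree_def)
  also have "\<dots> = binomial_pmf (N - 1) p"
    unfolding erdos_renyi_eq_random_subset
    using assms star_subset finite_vertex_pairs card_star finite_subset
    by (subst random_subset_Int) (auto simp: card_random_subset star_def)
  finally show ?thesis .
qed

lemma prob_degree:
  assumes "x \<in> {1..N}" "p \<in> {0..1}"
  shows "measure_pmf.prob (erdos_renyi N p) {E. Q (vertex_degree N E x)}
    = measure_pmf.prob (binomial_pmf (N - 1) p) {k. Q k}"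
  by (subst degree_binomial [OF assms, symmetric]) (simp add: vimage_def)

text \<open>Two degrees depend on each other only through the possible edge between the two vertices. If it
  is present, each vertex needs \<open>k - 1\<close> of its remaining \<open>N - 2\<close> potential edges, otherwise \<open>k\<close>
  of them.\<close>

lemma prob_two_degrees:
  assumes xy: "x \<in> {1..N}" "y \<in> {1..N}" "x \<noteq> y" and p: "p \<in> {0..1}" and k: "k \<ge> 1"
  shows "measure_pmf.prob (erdos_renyi N p) {E. vertex_degree N E x = k \<and> vertex_degree N E y = k}
    = p * (pmf (binomial_pmf (N - 2) p) (k - 1))\<^sup>2
      + (1 - p) * (pmf (binomial_pmf (N - 2) p) k)\<^sup>2"
proof -
  define e where "e = {x, y}"
  define A where "A = star N x - {e}"
  define B where "B = star N y - {e}"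
  have star_int: "star N x \<inter> star N y = {e}" using star_Int_star xy by (simp add: e_def)
  then have disj: "A \<inter> B = {}" "e \<notin> A" "e \<notin> B" and e_in: "e \<in> star N x" "e \<in> star N y"
    by (auto simp: A_def B_def)
  have sub: "A \<subseteq> vertex_pairs N" "B \<subseteq> vertex_pairs N" "e \<in> vertex_pairs N"
    using star_subset xy e_in by (auto simp: A_def B_def)
  have fin: "finite A" "finite B"
    using sub finite_vertex_pairs by (auto intro: finite_subset)
  have card: "card A = N - 2" "card B = N - 2"
    using card_star xy e_in by (auto simp: A_def B_def)
  have deg: "vertex_degree N E x = of_bool (e \<in> E) + card (E \<inter> A)"
            "vertex_degree N E y = of_bool (e \<in> E) + card (E \<inter> B)" for E
  proof -
    have "card (E \<inter> insert e S) = of_bool (e \<in> E) + card (E \<inter> S)" if "finite S" "e \<notin> S" for S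
      using that by (auto simp: Int_insert_right)
    moreover have "star N x = insert e A" "star N y = insert e B" using e_in by (auto simp: A_def B_def)
    ultimately show "vertex_degree N E x = of_bool (e \<in> E) + card (E \<inter> A)"
            "vertex_degree N E y = of_bool (e \<in> E) + card (E \<inter> B)"
      using fin disj by (auto simp: vertex_degree_def)
  qed
  \<comment> \<open>First separate \<open>B\<close> from \<open>e\<close> and \<open>A\<close>, then \<open>e\<close> from \<open>A\<close>.\<close>
  let ?R = "random_subset (vertex_pairs N) p"
  have key: "measure_pmf.prob ?R {E. (card (E \<inter> {e}) = i \<and> card (E \<inter> A) = j) \<and> card (E \<inter> B) = j}
      = pmf (binomial_pmf 1 p) i * (pmf (binomial_pmf (N - 2) p) j)\<^sup>2" for i j
  proof -
    let ?C = "insert e A"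
    have "{E. (card (E \<inter> {e}) = i \<and> card (E \<inter> A) = j) \<and> card (E \<inter> B) = j}
        = {E. (card (E \<inter> ?C \<inter> {e}) = i \<and> card (E \<inter> ?C \<inter> A) = j) \<and> card (E \<inter> B) = j}"
      using Int_absorb1[of "{e}" ?C] Int_absorb1[of A ?C] by (simp add: Int_assoc subset_insertI)
    then have "measure_pmf.prob ?R {E. (card (E \<inter> {e}) = i \<and> card (E \<inter> A) = j) \<and> card (E \<inter> B) = j}
        = measure_pmf.prob (random_subset ?C p) {E. card (E \<inter> {e}) = i \<and> card (E \<inter> A) = j}
          * measure_pmf.prob (binomial_pmf (N - 2) p) {l. l = j}"
      using prob_random_subset_indep [OF finite_vertex_pairs, of ?C N B p
          "\<lambda>E. card (E \<inter> {e}) = i \<and> card (E \<inter> A) = j" "\<lambda>l. l = j"] sub disj p card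
      by auto
    also have "measure_pmf.prob (random_subset ?C p) {E. card (E \<inter> {e}) = i \<and> card (E \<inter> A) = j}
        = measure_pmf.prob (random_subset {e} p) {E. card E = i}
          * measure_pmf.prob (binomial_pmf (N - 2) p) {l. l = j}"
      using prob_random_subset_indep [of ?C "{e}" A p "\<lambda>E. card E = i" "\<lambda>l. l = j"]
        fin disj p card by auto
    also have "measure_pmf.prob (random_subset {e} p) {E. card E = i}
        = measure_pmf.prob (map_pmf card (random_subset {e} p)) {i}"
      by (simp add: vimage_def)
    also have "map_pmf card (random_subset {e} p) = binomial_pmf 1 p"
      using p by (subst card_random_subset) auto
    finally show ?thesis
      by (simp add: measure_pmf_single power2_eq_square)
  qed
  have b: "of_bool (e \<in> E) = card (E \<inter> {e})" for E by auto
  have "{E. vertex_degree N E x = k \<and> vertex_degree N E y = k}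
      = {E. (card (E \<inter> {e}) = 1 \<and> card (E \<inter> A) = k - 1) \<and> card (E \<inter> B) = k - 1}
      \<union> {E. (card (E \<inter> {e}) = 0 \<and> card (E \<inter> A) = k) \<and> card (E \<inter> B) = k}"
    using k unfolding deg b[symmetric] by (auto simp: of_bool_def split: if_splits)
  then have "measure_pmf.prob ?R {E. vertex_degree N E x = k \<and> vertex_degree N E y = k}
      = measure_pmf.prob ?R {E. (card (E \<inter> {e}) = 1 \<and> card (E \<inter> A) = k - 1) \<and> card (E \<inter> B) = k - 1}
      + measure_pmf.prob ?R {E. (card (E \<inter> {e}) = 0 \<and> card (E \<inter> A) = k) \<and> card (E \<inter> B) = k}"
    by (simp only:) (rule measure_pmf.finite_measure_Union; auto)
  then show ?thesis
    unfolding key erdos_renyi_eq_random_subset using p by simp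
qed

section \<open>First and second moments of vertex counts\<close>

text \<open>Conditioning on the shared edge gives \<open>q = p * a + (1 - p) * c\<close>, so the covariance of the two
  events is \<open>p * (1 - p) * (a - c)\<^sup>2\<close>, the variance of a two-valued variable. Since \<open>a / c\<close>, a ratio of
  consecutive binomial weights, is at most of order \<open>k\<close>, the covariance is smaller than \<open>q\<^sup>2\<close> by
  the factor \<open>p * k\<^sup>2\<close>.\<close>

lemma binomial_pmf_second_moment:
  fixes p :: real
  assumes p: "0 \<le> p" "p \<le> 1/2" and k: "1 \<le> k" "k + 2 \<le> N"
    and big: "1 \<le> 2 * (real N - 1 - real k) * p"
  defines "q \<equiv> pmf (binomial_pmf (N - 1) p) k"
    and "a \<equiv> pmf (binomial_pmf (N - 2) p) (k - 1)"
    and "c \<equiv> pmf (binomial_pmf (N - 2) p) k"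
  shows "p * a\<^sup>2 + (1 - p) * c\<^sup>2 - q\<^sup>2 \<le> 16 * p * (real k)\<^sup>2 * q\<^sup>2"
proof -
  obtain n j where n: "N = Suc (Suc n)" and j: "k = Suc j"
  proof
    show "N = Suc (Suc (N - 2))" "k = Suc (k - 1)" using k by auto
  qed
  have jn: "j < n" using k n j by simp
  have a: "a = real (n choose j) * p ^ j * (1 - p) ^ (n - j)"
    and c: "c = real (n choose Suc j) * p ^ Suc j * (1 - p) ^ (n - Suc j)"
    and q: "q = real (Suc n choose Suc j) * p ^ Suc j * (1 - p) ^ (n - j)"
    using p by (auto simp: a_def c_def q_def n j)
  have pow: "(1 - p) ^ (n - j) = (1 - p) * (1 - p) ^ (n - Suc j)"
    using jn by (metis Suc_diff_Suc power_Suc)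
  have qac: "q = p * a + (1 - p) * c"
    unfolding a c q pow by (simp add: algebra_simps)
  have nonneg: "0 \<le> a" "0 \<le> c" by (auto simp: a_def c_def)
  have "a * ((real n - real j) * p) = ((real n - real j) * real (n choose j)) * p ^ Suc j * (1 - p) ^ (n - j)"
    unfolding a by (simp add: mult_ac)
  also have "\<dots> = real k * c * (1 - p)"
    unfolding binomial_Suc_ratio[OF jn, symmetric] c pow j by (simp only: mult_ac)
  also have "\<dots> \<le> real k * c * 1"
    using p nonneg by (intro mult_left_mono) auto
  finally have "a * (2 * (real n - real j) * p) \<le> 2 * real k * c" by (simp add: algebra_simps)
  moreover have "a * 1 \<le> a * (2 * (real n - real j) * p)"
    using big nonneg by (intro mult_left_mono) (auto simp: n j)
  ultimately have ac: "a \<le> 2 * real k * c" by simp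
  have "1 * c \<le> 2 * real k * c" using k nonneg by (intro mult_right_mono) auto
  then have "\<bar>a - c\<bar> \<le> 2 * real k * c" using ac nonneg by linarith
  moreover have "c \<le> 2 * q"
  proof -
    have "1 / 2 * c \<le> (1 - p) * c" using p nonneg by (intro mult_right_mono) auto
    then show ?thesis using qac p nonneg by (simp add: add_increasing)
  qed
  then have "2 * real k * c \<le> 4 * real k * q"
    using mult_left_mono[of c "2 * q" "2 * real k"] by simp
  ultimately have "\<bar>a - c\<bar> \<le> 4 * real k * q" by linarith
  then have "(a - c)\<^sup>2 \<le> (4 * real k * q)\<^sup>2"
    by (metis abs_ge_zero power2_abs power_mono)
  moreover have "p * a\<^sup>2 + (1 - p) * c\<^sup>2 - q\<^sup>2 = p * (1 - p) * (a - c)\<^sup>2"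
    unfolding qac by (simp add: power2_eq_square algebra_simps)
  moreover have "p * (1 - p) * (a - c)\<^sup>2 \<le> p * 1 * (4 * real k * q)\<^sup>2"
    using p calculation(1) by (intro mult_mono) auto
  ultimately show ?thesis by (simp add: power_mult_distrib)
qed

lemma integrable_erdos_renyi:
  fixes f :: "nat set set \<Rightarrow> real"
  shows "integrable (erdos_renyi N p) f"
proof (rule integrable_measure_pmf_finite)
  show "finite (set_pmf (erdos_renyi N p))"
    by (rule finite_subset[of _ "Pow (vertex_pairs N)"])
       (auto dest: set_erdos_renyi simp: finite_vertex_pairs)
qed

lemma expectation_of_bool:
  "measure_pmf.expectation M (\<lambda>E. of_bool (P E) :: real) = measure_pmf.prob M {E. P E}"
proof -
  have "(\<lambda>E. of_bool (P E) :: real) = indicator {E. P E}" by (auto simp: indicator_def fun_eq_iff)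
  then show ?thesis by simp
qed

text \<open>Chebyshev's inequality for the number of vertices of degree exactly \<open>k\<close>. The first term of the bound
  comes from the diagonal of the second moment, the second term from the covariances.\<close>

lemma prob_few_vertices_of_degree:
  fixes p :: real
  assumes p: "0 \<le> p" "p \<le> 1/2" and k: "1 \<le> k" "k + 2 \<le> N"
    and big: "1 \<le> 2 * (real N - 1 - real k) * p"
  defines "q \<equiv> pmf (binomial_pmf (N - 1) p) k"
  assumes q: "q > 0"
  shows "measure_pmf.prob (erdos_renyi N p)
      {E. real (card {x \<in> {1..N}. vertex_degree N E x = k}) \<le> real N * q / 2}
    \<le> 4 / (real N * q) + 64 * p * (real k)\<^sup>2"
proof -
  let ?G = "erdos_renyi N p"
  define X where "X E = (\<Sum>x\<in>{1..N}. of_bool (vertex_degree N E x = k) :: real)" for E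
  define J where "J = p * (pmf (binomial_pmf (N - 2) p) (k - 1))\<^sup>2 + (1 - p) * (pmf (binomial_pmf (N - 2) p) k)\<^sup>2"
  define \<mu> where "\<mu> = real N * q"
  have N: "real N > 0" using k by simp
  have \<mu>: "\<mu> > 0" using q N by (simp add: \<mu>_def)
  have p01: "p \<in> {0..1}" using p by auto
  note int = integrable_erdos_renyi
  have one: "measure_pmf.prob ?G {E. vertex_degree N E x = k} = q" if "x \<in> {1..N}" for x
    using prob_degree[OF that p01, of "\<lambda>l. l = k"] by (simp add: q_def measure_pmf_single)
  have EX: "measure_pmf.expectation ?G X = \<mu>"
    unfolding X_def by (subst Bochner_Integration.integral_sum) (auto simp: int expectation_of_bool one \<mu>_def)
  have "measure_pmf.expectation ?G (\<lambda>E. (X E)\<^sup>2)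
     = (\<Sum>x\<in>{1..N}. \<Sum>y\<in>{1..N}. measure_pmf.prob ?G {E. vertex_degree N E x = k \<and> vertex_degree N E y = k})"
  proof -
    have "(X E)\<^sup>2 = (\<Sum>x\<in>{1..N}. \<Sum>y\<in>{1..N}. of_bool (vertex_degree N E x = k \<and> vertex_degree N E y = k))" for E
      unfolding X_def power2_eq_square sum_product of_bool_conj ..
    then show ?thesis
      by (simp only: Bochner_Integration.integral_sum int Bochner_Integration.integrable_sum expectation_of_bool)
  qed
  also have "\<dots> \<le> (\<Sum>x\<in>{1..N}. \<Sum>y\<in>{1..N}. J + of_bool (x = y) * q)"
  proof (intro sum_mono)
    fix x y assume xy: "x \<in> {1..N}" "y \<in> {1..N}"
    have "J \<ge> 0" using p by (auto simp: J_def)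
    then show "measure_pmf.prob ?G {E. vertex_degree N E x = k \<and> vertex_degree N E y = k} \<le> J + of_bool (x = y) * q"
      using prob_two_degrees[OF xy _ p01 k(1)] one[OF xy(1)] by (cases "x = y") (auto simp: J_def)
  qed
  also have "\<dots> = (real N)\<^sup>2 * J + \<mu>"
    by (simp add: sum.distrib of_bool_def if_distrib[of "\<lambda>c. c * q"] \<mu>_def power2_eq_square
        cong: if_cong) (simp add: algebra_simps)
  finally have EX2: "measure_pmf.expectation ?G (\<lambda>E. (X E)\<^sup>2) \<le> (real N)\<^sup>2 * J + \<mu>" .
  have "measure_pmf.variance ?G X = measure_pmf.expectation ?G (\<lambda>E. (X E)\<^sup>2) - \<mu>\<^sup>2"
    by (subst measure_pmf.variance_eq) (auto simp: int EX)
  also have "\<dots> \<le> (real N)\<^sup>2 * (J - q\<^sup>2) + \<mu>"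
    using EX2 by (simp add: \<mu>_def power_mult_distrib algebra_simps)
  also have "\<dots> \<le> (real N)\<^sup>2 * (16 * p * (real k)\<^sup>2 * q\<^sup>2) + \<mu>"
    using binomial_pmf_second_moment[OF p k big]
    by (intro add_right_mono mult_left_mono) (auto simp: J_def q_def)
  also have "\<dots> = \<mu>\<^sup>2 * (16 * p * (real k)\<^sup>2) + \<mu>"
    by (simp add: \<mu>_def power_mult_distrib)
  finally have var: "measure_pmf.variance ?G X \<le> \<mu>\<^sup>2 * (16 * p * (real k)\<^sup>2) + \<mu>" .
  have "measure_pmf.prob ?G {E. real (card {x \<in> {1..N}. vertex_degree N E x = k}) \<le> real N * q / 2}
     \<le> measure_pmf.prob ?G {E \<in> space ?G. \<mu> / 2 \<le> \<bar>X E - measure_pmf.expectation ?G X\<bar>}"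
    unfolding EX using \<mu>
    by (intro measure_pmf.finite_measure_mono)
       (auto simp: X_def \<mu>_def sum_of_bool_eq Int_def mult.commute)
  also have "\<dots> \<le> measure_pmf.variance ?G X / (\<mu> / 2)\<^sup>2"
    by (rule measure_pmf.Chebyshev_inequality) (use \<mu> in \<open>auto simp: int\<close>)
  also have "\<dots> \<le> (\<mu>\<^sup>2 * (16 * p * (real k)\<^sup>2) + \<mu>) / (\<mu> / 2)\<^sup>2"
    using var by (intro divide_right_mono) auto
  also have "\<dots> = 4 / \<mu> + 64 * p * (real k)\<^sup>2"
    using \<mu> by (simp add: field_simps power2_eq_square)
  finally show ?thesis by (simp add: \<mu>_def)
qed

text \<open>Markov's inequality for the number of vertices of large degree, with the Chernoff bound for each.\<close>

lemma prob_many_vertices_of_large_degree: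
  assumes d: "0 < d" "d \<le> real N" and a: "1 \<le> a" and M: "M > 0"
  shows "measure_pmf.prob (erdos_renyi N (d / N))
      {E. M \<le> real (card {x \<in> {1..N}. d * a \<le> real (vertex_degree N E x)})}
    \<le> real N * exp (- d * rate a) / M"
proof -
  let ?G = "erdos_renyi N (d / N)"
  define X where "X E = (\<Sum>x\<in>{1..N}. of_bool (d * a \<le> real (vertex_degree N E x)) :: real)" for E
  have p: "d / N \<in> {0..1}" using d by (auto simp: divide_le_eq_1)
  note int = integrable_erdos_renyi
  have N: "real N > 0" using d by linarith
  have "measure_pmf.prob ?G {E. M \<le> real (card {x \<in> {1..N}. d * a \<le> real (vertex_degree N E x)})}
      = measure_pmf.prob ?G {E \<in> space ?G. M \<le> X E}"
    by (simp add: X_def sum_of_bool_eq Int_def)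
  also have "\<dots> \<le> measure_pmf.expectation ?G X / M"
    using M by (intro integral_Markov_inequality_measure[where A = "{}"]) (auto simp: int X_def intro!: sum_nonneg)
  also have "measure_pmf.expectation ?G X
      = (\<Sum>x\<in>{1..N}. measure_pmf.prob ?G {E. d * a \<le> real (vertex_degree N E x)})"
    unfolding X_def by (subst Bochner_Integration.integral_sum) (auto simp: int expectation_of_bool)
  also have "\<dots> \<le> (\<Sum>x\<in>{1..N}. exp (- d * rate a))"
  proof (intro sum_mono)
    fix x assume x: "x \<in> {1..N}"
    have "real (N - 1) * (d / N) \<le> real N * (d / N)" using d by (intro mult_right_mono) auto
    then have "real (N - 1) * (d / N) \<le> d" using N by simp
    then show "measure_pmf.prob ?G {E. d * a \<le> real (vertex_degree N E x)} \<le> exp (- d * rate a)"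
      unfolding prob_degree[OF x p, of "\<lambda>l. d * a \<le> real l"] by (rule binomial_Chernoff[OF p a])
  qed
  finally show ?thesis using M by (simp add: divide_right_mono)
qed

section \<open>The function \<Lambda> and the maximal density\<close>

text \<open>In the parameter \<open>s = sqrt (a - 1)\<close>, where \<open>s \<ge> 1\<close>, the function becomes \<open>s + 1 / s\<close>. It is
  strictly increasing and has slope at most \<open>1\<close> in \<open>s\<close>, while \<open>a\<close> itself has slope at least \<open>2\<close>.\<close>

lemma \<Lambda>_increment:
  assumes "2 \<le> a" "a < b"
  shows "\<Lambda> a < \<Lambda> b" "2 * (\<Lambda> b - \<Lambda> a) \<le> b - a"
proof -
  define s t where "s = sqrt (a - 1)" and "t = sqrt (b - 1)"
  have s: "1 \<le> s" and st: "s < t" using assms by (auto simp: s_def t_def)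
  have "a - 1 = s\<^sup>2" "b - 1 = t\<^sup>2" using assms by (auto simp: s_def t_def)
  then have ab: "a = 1 + s\<^sup>2" "b = 1 + t\<^sup>2" by auto
  have \<Lambda>: "\<Lambda> (1 + r\<^sup>2) = r + 1 / r" if "r \<ge> 1" for r
    using that by (simp add: \<Lambda>_def field_simps power2_eq_square)
  have "s * t > 1" using s st by (metis less_1_mult mult_1 order_le_less order_less_le_trans)
  have diff: "\<Lambda> b - \<Lambda> a = (t - s) * (1 - 1 / (s * t))"
    using s st unfolding ab by (simp add: \<Lambda> field_simps)
  have "(t - s) * (1 - 1 / (s * t)) > 0"
    using st \<open>s * t > 1\<close> by (intro mult_pos_pos) auto
  then show "\<Lambda> a < \<Lambda> b" using diff by simp
  have "2 * (\<Lambda> b - \<Lambda> a) \<le> 2 * ((t - s) * 1)"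
    unfolding diff using st \<open>s * t > 1\<close> by (intro mult_left_mono) auto
  also have "\<dots> \<le> (t - s) * (t + s)"
    using mult_left_mono[of 2 "t + s" "t - s"] s st by simp
  also have "\<dots> = b - a" unfolding ab by (simp add: algebra_simps power2_eq_square)
  finally show "2 * (\<Lambda> b - \<Lambda> a) \<le> b - a" .
qed

lemma \<Lambda>_le_iff:
  assumes "2 \<le> a" "2 \<le> b"
  shows "\<Lambda> a \<le> \<Lambda> b \<longleftrightarrow> a \<le> b"
  using \<Lambda>_increment(1)[of a b] \<Lambda>_increment(1)[of b a] assms
  by (metis linorder_not_le order_less_imp_le order_refl order_le_less)

text \<open>The preimage is \<open>1 + s\<^sup>2\<close>, where \<open>s\<close> is the larger root of \<open>s + 1 / s = l\<close>.\<close>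

lemma \<Lambda>_inv:
  assumes "l \<ge> 2"
  shows "\<Lambda>_inv l \<ge> 2" "\<Lambda> (\<Lambda>_inv l) = l"
proof -
  define r where "r = sqrt (l\<^sup>2 - 4)"
  define s where "s = (l + r) / 2"
  have "l\<^sup>2 \<ge> 2\<^sup>2" using assms by (intro power_mono) auto
  then have r: "r \<ge> 0" "r\<^sup>2 = l\<^sup>2 - 4" by (auto simp: r_def)
  have s: "s \<ge> 1" using r assms by (simp add: s_def)
  have "1 + s\<^sup>2 = l * s"
    using r(2) by (simp add: s_def power2_eq_square field_simps)
  then have "\<Lambda> (1 + s\<^sup>2) = l * s / s" using s by (simp add: \<Lambda>_def flip: \<open>1 + s\<^sup>2 = l * s\<close>)
  then have "\<Lambda> (1 + s\<^sup>2) = l" using s by simp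
  moreover have "1 \<le> s\<^sup>2" using s by simp
  ultimately have "l \<in> \<Lambda> ` {2..}" by (intro image_eqI[of _ _ "1 + s\<^sup>2"]) auto
  then show "\<Lambda>_inv l \<ge> 2" "\<Lambda> (\<Lambda>_inv l) = l"
    unfolding \<Lambda>_inv_def using inv_into_into[of l \<Lambda> "{2..}"] by (simp_all add: f_inv_into_f)
qed

lemma \<theta>_eq_rate: "\<theta> b a = max 0 (1 - b * rate a)"
  by (simp add: \<theta>_def rate_def)

lemma \<alpha>_max_ge_2:
  assumes "b > 0"
  shows "2 \<le> \<alpha>_max b"
proof -
  define a where "a = max 2 (6 / b)"
  have "b * (a / 6) \<le> b * rate a"
    using assms by (intro mult_left_mono rate_ge_linear) (auto simp: a_def)
  moreover have "b * a \<ge> 6" using assms by (simp add: a_def max_def field_simps)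
  ultimately have "\<theta> b a = 0" by (simp add: \<theta>_eq_rate)
  then show ?thesis
    unfolding \<alpha>_max_def by (intro cInf_greatest) (auto intro!: exI[of _ a] simp: a_def)
qed

text \<open>Strict inequality lets the infimum be used without deciding whether it is attained; this is why
  the proof below works at the midpoint of \<open>\<alpha>\<close> and \<open>\<beta>\<close> and never at \<open>\<beta>\<close>.\<close>

lemma rate_less_\<alpha>_max:
  assumes "2 \<le> t" "t < \<alpha>_max b"
  shows "b * rate t < 1"
proof (rule ccontr)
  assume "\<not> b * rate t < 1"
  then have "t \<in> {a. a \<ge> 2 \<and> \<theta> b a = 0}" using assms by (simp add: \<theta>_eq_rate)
  then have "\<alpha>_max b \<le> t"
    unfolding \<alpha>_max_def by (intro cInf_lower) auto
  then show False using assms by simp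
qed

section \<open>Concentration of the vertex counts\<close>

text \<open>The estimate for a fixed \<open>N\<close>. The sets \<open>S E\<close> are only required to lie between the vertices with
  normalised degree in \<open>[\<alpha>, \<beta>]\<close> and those with normalised degree at least \<open>\<alpha>\<close>, which covers both
  parts of the theorem. The error bound depends neither on \<open>d\<close> nor on the other parameters,
  so it is enough that it tends to zero.

  The lower bound uses the vertices of degree \<open>k = \<lceil>d * \<alpha>\<rceil>\<close> alone. Rounding \<open>d * \<alpha>\<close> up costs a factor
  \<open>k / d\<close>, Stirling's formula a factor \<open>k\<close>, together \<open>O(L\<^sup>2)\<close>. The lower bound on \<open>\<beta> - \<alpha>\<close> enters
  twice: it leaves room for the integer \<open>k\<close>, and it keeps \<open>\<theta> b \<alpha>\<close> away from zero, so that the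
  expected number of such vertices tends to infinity. Since \<open>d \<le> 3 * L\<close> and \<open>k \<le> 6 * L\<close>, the assumption
  \<open>84 * L\<^sup>2 \<le> real N\<close> ensures \<open>2 * k * (k + 1) \<le> N\<close>, and \<open>6912 = 64 * 3 * 6\<^sup>2\<close> comes from the covariance term
  \<open>64 * (d / N) * k\<^sup>2\<close>.\<close>

lemma prob_count_near_expectation:
  fixes N :: nat and d b \<alpha> \<beta> \<zeta> :: real and S :: "nat set set \<Rightarrow> nat set"
  defines "L \<equiv> ln (real N)"
  assumes L: "L \<ge> 24" and NL: "84 * L\<^sup>2 \<le> real N"
    and \<zeta>: "\<zeta> \<ge> 10" and d: "1 \<le> d" and dL: "d = b * L"
    and \<alpha>\<beta>: "2 \<le> \<alpha>" "\<alpha> < \<beta>" "\<beta> \<le> \<alpha>_max b"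
    and gap: "\<zeta> * ln L / (d * ln \<alpha>) \<le> \<beta> - \<alpha>"
    and S: "\<And>E. E \<subseteq> vertex_pairs N \<Longrightarrow>
        {x \<in> {1..N}. \<alpha> \<le> norm_degree N d E x \<and> norm_degree N d E x \<le> \<beta>} \<subseteq> S E"
      "\<And>E. E \<subseteq> vertex_pairs N \<Longrightarrow> S E \<subseteq> {x \<in> {1..N}. \<alpha> \<le> norm_degree N d E x}"
  shows "1 - (5 / L + 6912 * L ^ 3 / real N) \<le> measure_pmf.prob (erdos_renyi N (d / real N))
      {E. real N powr \<theta> b \<alpha> * L powr (- \<zeta>) \<le> real (card (S E))
          \<and> real (card (S E)) \<le> real N powr \<theta> b \<alpha> * L powr \<zeta>}"
proof -
  define t where "t = (\<alpha> + \<beta>) / 2"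
  define k where "k = nat \<lceil>d * \<alpha>\<rceil>"
  define p where "p = d / real N"
  define q where "q = pmf (binomial_pmf (N - 1) p) k"
  define V where "V = real N powr \<theta> b \<alpha>"
  let ?G = "erdos_renyi N p"
  have L2: "24 * L \<le> L\<^sup>2" using L by (simp add: power2_eq_square)
  have N: "real N > 0" "real N \<ge> 48384"
  proof -
    have "84 * (24 * 24) \<le> 84 * (L * L)" using L by (intro mult_left_mono mult_mono) auto
    then show "real N \<ge> 48384" using NL by (simp add: power2_eq_square)
    then show "real N > 0" by linarith
  qed
  have "0 < b * L" using d dL by linarith
  then have b: "b > 0" using L by (simp add: zero_less_mult_iff)
  have t: "2 \<le> t" "\<alpha> < t" "t < \<beta>" "t < \<alpha>_max b" using \<alpha>\<beta> by (auto simp: t_def)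
  have bt1: "b * rate t < 1" using t by (intro rate_less_\<alpha>_max) auto
  have bt: "b * t \<le> 6"
  proof -
    have "b * (t / 6) \<le> b * rate t"
      using rate_ge_linear[OF t(1)] b by (intro mult_left_mono) auto
    then show ?thesis using bt1 by simp
  qed
  have dt: "d * t \<le> 6 * L"
    using mult_right_mono[OF bt, of L] L by (simp add: dL mult_ac)
  have d3: "d \<le> 3 * L"
    using mult_left_mono[OF t(1), of d] d dt by linarith
  have t6: "t \<le> 6 * L"
    using mult_right_mono[OF d, of t] t(1) dt by linarith
  have lnL: "ln L \<ge> 0" using L by simp
  have ln\<alpha>: "ln \<alpha> > 0" using \<alpha>\<beta> by simp
  have "ln \<alpha> \<le> ln (6 * L)" using \<alpha>\<beta> t t6 by (intro ln_mono) auto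
  also have "\<dots> = ln 6 + ln L" using L by (simp add: ln_mult)
  also have "\<dots> \<le> 2 * ln L" using L by simp
  finally have ln\<alpha>L: "ln \<alpha> \<le> 2 * ln L" .
  have gap': "\<zeta> * ln L \<le> (\<beta> - \<alpha>) * (d * ln \<alpha>)"
    using gap ln\<alpha> d by (simp add: pos_divide_le_eq)
  have "10 * (ln \<alpha> / 2) \<le> \<zeta> * ln L"
    using \<zeta> ln\<alpha> ln\<alpha>L by (intro mult_mono) auto
  then have "5 * ln \<alpha> \<le> (d * (\<beta> - \<alpha>)) * ln \<alpha>" using gap' by (simp add: mult_ac)
  then have gap2: "5 \<le> d * (\<beta> - \<alpha>)" using ln\<alpha> by (simp add: mult_le_cancel_right)

  \<comment> \<open>The integer \<open>k\<close> fits between \<open>d * \<alpha>\<close> and \<open>d * t\<close>.\<close>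
  have k_ge: "d * \<alpha> \<le> real k" unfolding k_def by linarith
  have "d * \<alpha> > 0" using d \<alpha>\<beta> by simp
  then have k_less: "real k \<le> d * \<alpha> + 1" and k1: "k \<ge> 1" unfolding k_def by linarith+
  have k_le_t: "real k \<le> d * t"
    using k_less gap2 by (simp add: t_def algebra_simps)
  have k6: "real k \<le> 6 * L" using k_le_t dt by simp
  have k0: "real k > 0" using k1 by simp
  have \<kappa>: "\<alpha> \<le> real k / d" "real k / d \<le> t"
    using k_ge k_le_t d by (auto simp: field_simps)

  \<comment> \<open>Up to the midpoint \<open>t\<close> the rate increases by enough to make \<open>N powr \<theta> b \<alpha>\<close> a large power of \<open>L\<close>.\<close>
  have bt\<alpha>: "b * (ln \<alpha> * (t - \<alpha>)) \<le> b * rate t - b * rate \<alpha>"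
    using rate_tangent[of \<alpha> t] t \<alpha>\<beta> b mult_left_mono[of "ln \<alpha> * (t - \<alpha>)" "rate t - rate \<alpha>" b]
    by (simp add: right_diff_distrib)
  moreover have "b * (ln \<alpha> * (t - \<alpha>)) \<ge> 0" using b ln\<alpha> t by simp
  ultimately have \<theta>: "\<theta> b \<alpha> = 1 - b * rate \<alpha>" using bt1 by (simp add: \<theta>_eq_rate)
  have "\<zeta> * ln L / 2 \<le> b * (ln \<alpha> * (t - \<alpha>)) * L"
    using gap' by (simp add: dL t_def field_simps)
  also have "\<dots> \<le> (1 - b * rate \<alpha>) * L"
    using bt\<alpha> bt1 L by (intro mult_right_mono) auto
  finally have "\<zeta> * ln L / 2 \<le> \<theta> b \<alpha> * L" by (simp add: \<theta>)
  moreover have "5 * ln L \<le> \<zeta> * ln L / 2" using \<zeta> lnL mult_right_mono[of 10 \<zeta> "ln L"] by simp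
  ultimately have "exp (5 * ln L) \<le> V" using N by (simp add: V_def powr_def L_def)
  moreover have "exp (5 * ln L) = L ^ 5"
    using exp_of_nat_mult[of 5 "ln L"] L by simp
  ultimately have V: "L ^ 5 \<le> V" by simp
  have "V = exp (L + - d * rate \<alpha>)"
    using N by (simp add: V_def \<theta> powr_def L_def dL algebra_simps)
  then have V_eq: "real N * exp (- d * rate \<alpha>) = V"
    unfolding exp_add using N by (simp add: L_def)

  have small: "24 * L \<le> real N"
    using L2 NL L by linarith
  have p: "0 \<le> p" "p \<le> 1/2" using d d3 small N by (auto simp: p_def field_simps)
  have kN: "2 * k * (k + 1) \<le> N"
  proof -
    have "2 * real k * (real k + 1) \<le> 2 * (6 * L) * (7 * L)"
      using k6 L by (intro mult_mono) auto
    also have "\<dots> \<le> real N" using NL by (simp add: power2_eq_square)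
    finally have "real (2 * k * (k + 1)) \<le> real N" by (simp add: algebra_simps)
    then show ?thesis by (simp only: of_nat_le_iff)
  qed
  have dN: "2 * d\<^sup>2 \<le> real N"
  proof -
    have "d\<^sup>2 \<le> (3 * L)\<^sup>2" using d d3 by (intro power_mono) auto
    then show ?thesis using NL by (simp add: power_mult_distrib)
  qed
  \<comment> \<open>The tangent at the larger point \<open>k / d\<close> bounds the cost of rounding \<open>d * \<alpha>\<close> up to \<open>k\<close>.\<close>
  have "rate (real k / d) + ln (real k / d) * (\<alpha> - real k / d) \<le> rate \<alpha>"
    using k0 d \<alpha>\<beta> by (intro rate_tangent) auto
  then have "d * (rate (real k / d) + ln (real k / d) * (\<alpha> - real k / d)) \<le> d * rate \<alpha>"
    using d by (intro mult_left_mono) auto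
  moreover have "d * (x + y * (\<alpha> - real k / d)) = d * x - y * (real k - d * \<alpha>)" for x y
    using d by (simp add: field_simps)
  ultimately have "d * rate (real k / d) \<le> d * rate \<alpha> + ln (real k / d) * (real k - d * \<alpha>)"
    by simp
  moreover have "ln (real k / d) * (real k - d * \<alpha>) \<le> ln (6 * L) * 1"
    using \<kappa> \<alpha>\<beta> t6 L k_less k_ge by (intro mult_mono ln_mono) auto
  ultimately have "exp (- d * rate \<alpha> - ln (6 * L)) \<le> exp (- d * rate (real k / d))" by simp
  then have "exp (- d * rate \<alpha>) / (6 * L) \<le> exp (- d * rate (real k / d))"
    using L by (simp add: exp_diff)
  then have "exp (- d * rate \<alpha>) / (6 * L) / (16 * (6 * L)) \<le> exp (- d * rate (real k / d)) / (16 * real k)"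
    using k6 k0 L by (intro frac_le) auto
  also have "\<dots> \<le> q"
    unfolding q_def p_def by (rule binomial_pmf_ge_rate) (use d kN k1 dN in auto)
  finally have "real N * (exp (- d * rate \<alpha>) / (6 * L) / (16 * (6 * L))) \<le> real N * q"
    using N by (intro mult_left_mono) auto
  then have \<mu>: "V / (576 * L\<^sup>2) \<le> real N * q"
    using V_eq by (simp add: power2_eq_square mult_ac)
  have "576 * L ^ 3 \<le> L ^ 5" 
    using mult_right_mono[of "24 * 24" "L * L" "L ^ 3"] L mult_mono[of 24 L 24 L]
    by (simp add: eval_nat_numeral)
  then have "L * (576 * L\<^sup>2) \<le> V" using V by (simp add: eval_nat_numeral)
  then have "L \<le> V / (576 * L\<^sup>2)" using L by (simp add: le_divide_eq)
  then have \<mu>L: "L \<le> real N * q" using \<mu> by simp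
  then have "0 < real N * q" using L by linarith
  then have q: "q > 0" by (simp add: zero_less_mult_iff)

  have "1152 * L\<^sup>2 \<le> L ^ 10"
  proof -
    have "(24::real) ^ 8 \<le> L ^ 8" using L by (intro power_mono) auto
    then have "1152 \<le> L ^ 8" by simp
    then have "1152 * L\<^sup>2 \<le> L ^ 8 * L\<^sup>2" by (intro mult_right_mono) auto
    then show ?thesis by (simp flip: power_add)
  qed
  also have "L ^ 10 = L powr 10" using L by (simp add: powr_numeral)
  also have "\<dots> \<le> L powr \<zeta>" using \<zeta> L by (intro powr_mono) auto
  finally have L\<zeta>: "1152 * L\<^sup>2 \<le> L powr \<zeta>" .
  have V0: "V > 0" using N by (simp add: V_def)
  have "V * L powr (- \<zeta>) = V / L powr \<zeta>" by (simp add: powr_minus divide_inverse)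
  also have "\<dots> \<le> V / (1152 * L\<^sup>2)" using L\<zeta> V0 L by (intro divide_left_mono) auto
  also have "\<dots> \<le> real N * q / 2" using \<mu> by simp
  finally have lower: "V * L powr (- \<zeta>) \<le> real N * q / 2" .

  have "4 / (real N * q) + 64 * p * (real k)\<^sup>2 \<le> 4 / L + 6912 * L ^ 3 / real N"
  proof (intro add_mono)
    show "4 / (real N * q) \<le> 4 / L" using \<mu>L L by (intro divide_left_mono) auto
    have "64 * p * (real k)\<^sup>2 \<le> 64 * (3 * L / real N) * (6 * L)\<^sup>2"
      using d3 p k6 N unfolding p_def by (intro mult_mono power_mono divide_right_mono) auto
    then show "64 * p * (real k)\<^sup>2 \<le> 6912 * L ^ 3 / real N"
      by (simp add: power2_eq_square power3_eq_cube)
  qed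
  moreover have "measure_pmf.prob ?G {E. real (card {x \<in> {1..N}. vertex_degree N E x = k}) \<le> real N * q / 2}
     \<le> 4 / (real N * q) + 64 * p * (real k)\<^sup>2"
    unfolding q_def
  proof (rule prob_few_vertices_of_degree [OF p k1])
    show "k + 2 \<le> N" using k6 small N by linarith
    have "real N / 2 * p \<le> (real N - 1 - real k) * p"
      using k6 small N p L by (intro mult_right_mono) auto
    moreover have "real N / 2 * p \<ge> 1 / 2" using N d by (simp add: p_def)
    ultimately show "1 \<le> 2 * (real N - 1 - real k) * p" by (simp only: mult.assoc)
  qed (use q q_def in simp)
  ultimately have few: "measure_pmf.prob ?G {E. real (card {x \<in> {1..N}. vertex_degree N E x = k}) \<le> real N * q / 2}
     \<le> 4 / L + 6912 * L ^ 3 / real N" by linarith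

  have "measure_pmf.prob ?G {E. V * L powr \<zeta> \<le> real (card {x \<in> {1..N}. d * \<alpha> \<le> real (vertex_degree N E x)})}
      \<le> real N * exp (- d * rate \<alpha>) / (V * L powr \<zeta>)"
    unfolding p_def
    using d d3 small \<alpha>\<beta> V0 L by (intro prob_many_vertices_of_large_degree) auto
  also have "\<dots> = 1 / L powr \<zeta>" using V0 unfolding V_eq by simp
  also have "\<dots> \<le> 1 / L powr 1" using L \<zeta> by (intro divide_left_mono powr_mono) auto
  finally have many: "measure_pmf.prob ?G {E. V * L powr \<zeta> \<le> real (card {x \<in> {1..N}. d * \<alpha> \<le> real (vertex_degree N E x)})}
      \<le> 1 / L" using L by simp

  let ?good = "{E. V * L powr (- \<zeta>) \<le> real (card (S E)) \<and> real (card (S E)) \<le> V * L powr \<zeta>}"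
  let ?few = "{E. real (card {x \<in> {1..N}. vertex_degree N E x = k}) \<le> real N * q / 2}"
  let ?many = "{E. V * L powr \<zeta> \<le> real (card {x \<in> {1..N}. d * \<alpha> \<le> real (vertex_degree N E x)})}"
  have "E \<in> ?few \<union> ?many \<union> ?good" if "E \<in> set_pmf ?G" for E
  proof -
    have E: "E \<subseteq> vertex_pairs N" using that by (rule set_erdos_renyi)
    have "S E \<subseteq> {x \<in> {1..N}. d * \<alpha> \<le> real (vertex_degree N E x)}"
      using S(2)[OF E] d by (auto simp: norm_degree_eq[OF E] field_simps)
    then have 1: "card (S E) \<le> card {x \<in> {1..N}. d * \<alpha> \<le> real (vertex_degree N E x)}"
      by (intro card_mono) auto
    have "{x \<in> {1..N}. vertex_degree N E x = k} \<subseteq> S E"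
      using S(1)[OF E] \<kappa> t by (auto simp: norm_degree_eq[OF E])
    moreover have "finite (S E)" using S(2)[OF E] by (rule finite_subset) simp
    ultimately have 2: "card {x \<in> {1..N}. vertex_degree N E x = k} \<le> card (S E)"
      by (intro card_mono)
    show ?thesis using 1 2 lower by (auto simp: not_le)
  qed
  then have "1 = measure_pmf.prob ?G (?few \<union> ?many \<union> ?good)"
    by (subst measure_pmf.prob_eq_1 [THEN iffD2]) (auto intro!: AE_pmfI)
  also have "\<dots> \<le> measure_pmf.prob ?G ?few + measure_pmf.prob ?G ?many + measure_pmf.prob ?G ?good"
    by (intro order_trans[OF measure_Un_le] add_right_mono) auto
  finally have "1 - (4 / L + 6912 * L ^ 3 / real N + 1 / L) \<le> measure_pmf.prob ?G ?good"
    using few many by linarith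
  then show ?thesis by (simp add: V_def p_def L_def add_divide_distrib [symmetric])
qed

text \<open>On the logarithmic scale a factor \<open>ln N powr \<zeta>\<close> is a shift of the exponent of \<open>N\<close> by
  \<open>\<zeta> * ln (ln N) / ln N\<close>, which is the admissible error with constant \<open>1\<close>.\<close>

lemma whp_count:
  fixes d b \<alpha> \<beta> \<zeta> :: "nat \<Rightarrow> real" and S :: "nat \<Rightarrow> nat set set \<Rightarrow> nat set"
  assumes db: "\<forall>\<^sub>F N in sequentially. d N = b N * ln (real N)"
    and \<zeta>: "filterlim \<zeta> at_top sequentially"
    and \<zeta>d: "\<forall>\<^sub>F N in sequentially. \<zeta> N * ln (ln (real N)) \<le> d N"
    and \<alpha>\<beta>: "\<forall>\<^sub>F N in sequentially. 2 \<le> \<alpha> N \<and> \<alpha> N < \<beta> N \<and> \<beta> N \<le> \<alpha>_max (b N)"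
    and gap: "\<forall>\<^sub>F N in sequentially. \<zeta> N * ln (ln (real N)) / (d N * ln (\<alpha> N)) \<le> \<beta> N - \<alpha> N"
    and S: "\<forall>\<^sub>F N in sequentially. \<forall>E. E \<subseteq> vertex_pairs N \<longrightarrow>
        {x \<in> {1..N}. \<alpha> N \<le> norm_degree N (d N) E x \<and> norm_degree N (d N) E x \<le> \<beta> N} \<subseteq> S N E \<and>
        S N E \<subseteq> {x \<in> {1..N}. \<alpha> N \<le> norm_degree N (d N) E x}"
  shows "whp (\<lambda>N. erdos_renyi N (d N / real N))
      (\<lambda>N E. \<exists>\<epsilon>. \<bar>\<epsilon>\<bar> \<le> \<zeta> N * ln (ln (real N)) / ln (real N) \<and>
         real (card (S N E)) = real N powr (\<theta> (b N) (\<alpha> N) + \<epsilon>))"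
    (is "whp _ ?P")
  unfolding whp_def
proof (rule tendsto_sandwich)
  let ?lower = "\<lambda>N. 1 - (5 / ln (real N) + 6912 * ln (real N) ^ 3 / real N)"
  show "?lower \<longlonglongrightarrow> 1" by real_asymp
  have "\<forall>\<^sub>F N in sequentially. ln (real N) \<ge> 24" by real_asymp
  moreover have "\<forall>\<^sub>F N in sequentially. ln (ln (real N)) \<ge> 1" by real_asymp
  moreover have "\<forall>\<^sub>F N in sequentially. 84 * (ln (real N))\<^sup>2 \<le> real N" by real_asymp
  moreover have "\<forall>\<^sub>F N in sequentially. \<zeta> N \<ge> 10"
    using \<zeta> by (auto simp: filterlim_at_top)
  ultimately show "\<forall>\<^sub>F N in sequentially. ?lower N
      \<le> measure_pmf.prob (erdos_renyi N (d N / real N)) {E. ?P N E}"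
    using db \<zeta>d \<alpha>\<beta> gap S
  proof eventually_elim
    case (elim N)
    let ?L = "ln (real N)"
    have "0 < ln (real N)" using elim(1) by linarith
    then have N: "real N > 1" by (cases "N = 0") (simp_all add: ln_gt_zero_iff)
    have "1 * 1 \<le> \<zeta> N * ln ?L" using elim by (intro mult_mono) auto
    then have d: "1 \<le> d N" using elim by linarith
    have "?lower N \<le> measure_pmf.prob (erdos_renyi N (d N / real N))
      {E. real N powr \<theta> (b N) (\<alpha> N) * ?L powr (- \<zeta> N) \<le> real (card (S N E))
          \<and> real (card (S N E)) \<le> real N powr \<theta> (b N) (\<alpha> N) * ?L powr \<zeta> N}"
      using elim d by (intro prob_count_near_expectation[where \<beta> = "\<beta> N"]) auto
    also have "\<dots> \<le> measure_pmf.prob (erdos_renyi N (d N / real N)) {E. ?P N E}"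
    proof (intro measure_pmf.finite_measure_mono subsetI CollectI)
      fix E
      let ?m = "real (card (S N E))" and ?\<theta> = "\<theta> (b N) (\<alpha> N)"
      assume "E \<in> {E. real N powr ?\<theta> * ?L powr (- \<zeta> N) \<le> real (card (S N E))
          \<and> real (card (S N E)) \<le> real N powr ?\<theta> * ?L powr \<zeta> N}"
      then have m: "real N powr ?\<theta> * ?L powr (- \<zeta> N) \<le> ?m" "?m \<le> real N powr ?\<theta> * ?L powr \<zeta> N" by auto
      have L: "?L > 0" using elim(1) by linarith
      have "0 < real N powr ?\<theta> * ?L powr (- \<zeta> N)" using N L by simp
      then have m0: "?m > 0" using m(1) by linarith
      have "ln (real N powr ?\<theta> * ?L powr (- \<zeta> N)) \<le> ln ?m" "ln ?m \<le> ln (real N powr ?\<theta> * ?L powr \<zeta> N)"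
        using m m0 N L by (auto intro!: ln_mono)
      then have lnm: "\<bar>ln ?m - ?\<theta> * ?L\<bar> \<le> \<zeta> N * ln ?L"
        using N L by (simp add: ln_mult ln_powr abs_le_iff)
      define \<epsilon> where "\<epsilon> = (ln ?m - ?\<theta> * ?L) / ?L"
      have "\<bar>\<epsilon>\<bar> \<le> \<zeta> N * ln ?L / ?L"
        unfolding \<epsilon>_def abs_divide using lnm L by (simp add: divide_right_mono)
      moreover have "?m = real N powr (?\<theta> + \<epsilon>)"
        using N L m0 by (simp add: powr_def \<epsilon>_def field_simps)
      ultimately show "?P N E" by blast
    qed simp
    finally show ?case .
  qed
qed auto

theorem lemmaA12:
  "\<exists>C\<^sub>0 > (0::real). \<exists>K > (0::real). \<forall>C \<ge> C\<^sub>0.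
     \<forall>(d :: nat \<Rightarrow> real) (b :: nat \<Rightarrow> real) (\<zeta> :: nat \<Rightarrow> real).
       (\<forall>\<^sub>F N in sequentially. 0 \<le> d N \<and> d N \<le> real N) \<longrightarrow>
       (\<forall>\<^sub>F N in sequentially. d N = b N * ln (real N)) \<longrightarrow>
       filterlim \<zeta> at_top sequentially \<longrightarrow>
       (\<forall>\<^sub>F N in sequentially. \<zeta> N \<le> d N / (C * ln (ln (real N)))) \<longrightarrow>
       (\<forall>(\<alpha> :: nat \<Rightarrow> real) (\<beta> :: nat \<Rightarrow> real).
          (\<forall>\<^sub>F N in sequentially. 2 \<le> \<alpha> N \<and> \<alpha> N < \<beta> N \<and> \<beta> N \<le> \<alpha>_max (b N)) \<longrightarrow>
          (\<forall>\<^sub>F N in sequentially.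
             \<beta> N - \<alpha> N \<ge> C * (\<zeta> N * ln (ln (real N)) / (d N * ln (\<alpha> N)))) \<longrightarrow>
          whp (\<lambda>N. erdos_renyi N (d N / real N))
            (\<lambda>N E. \<exists>\<epsilon>. \<bar>\<epsilon>\<bar> \<le> K * (\<zeta> N * ln (ln (real N)) / ln (real N)) \<and>
               real (card {x \<in> {1..N}. \<alpha> N \<le> norm_degree N (d N) E x \<and>
                                        norm_degree N (d N) E x \<le> \<beta> N})
                 = real N powr (\<theta> (b N) (\<alpha> N) + \<epsilon>))) \<and>
       (\<forall>(l :: nat \<Rightarrow> real) (\<delta> :: nat \<Rightarrow> real).
          (\<forall>\<^sub>F N in sequentially. \<delta> N \<ge> C * (\<zeta> N * ln (ln (real N)) / d N)) \<longrightarrow>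
          (\<forall>\<^sub>F N in sequentially. 2 + \<delta> N \<le> l N \<and> l N \<le> \<Lambda> (\<alpha>_max (b N))) \<longrightarrow>
          whp (\<lambda>N. erdos_renyi N (d N / real N))
            (\<lambda>N E. \<exists>\<epsilon>. \<bar>\<epsilon>\<bar> \<le> K * (\<zeta> N * ln (ln (real N)) / ln (real N)) \<and>
               real (card (\<W> N (d N) E (l N) (\<delta> N)))
                 = real N powr (\<theta> (b N) (\<Lambda>_inv (l N - \<delta> N)) + \<epsilon>)))"
proof (rule exI[of _ 1], intro conjI, simp, rule exI[of _ 1], intro conjI, simp, intro allI impI conjI)
  fix C :: real and d b \<zeta> :: "nat \<Rightarrow> real"
  assume C: "1 \<le> C"
    and db: "\<forall>\<^sub>F N in sequentially. d N = b N * ln (real N)"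
    and \<zeta>: "filterlim \<zeta> at_top sequentially"
    and \<zeta>d: "\<forall>\<^sub>F N in sequentially. \<zeta> N \<le> d N / (C * ln (ln (real N)))"
  have ev: "\<forall>\<^sub>F N in sequentially. 1 \<le> ln (real N)" "\<forall>\<^sub>F N in sequentially. 1 \<le> ln (ln (real N))"
    by real_asymp+
  have \<zeta>1: "\<forall>\<^sub>F N in sequentially. 1 \<le> \<zeta> N"
    using \<zeta> by (auto simp: filterlim_at_top)
  have \<zeta>d': "\<forall>\<^sub>F N in sequentially. \<zeta> N * ln (ln (real N)) \<le> d N"
    using \<zeta>d ev(2) \<zeta>1
  proof eventually_elim
    case (elim N)
    have "1 * (\<zeta> N * ln (ln (real N))) \<le> C * (\<zeta> N * ln (ln (real N)))"
      using elim C by (intro mult_right_mono) auto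
    also have "\<dots> \<le> d N" using elim C by (simp add: le_divide_eq mult_ac)
    finally show ?case by simp
  qed
  have pos: "\<forall>\<^sub>F N in sequentially. 1 \<le> \<zeta> N * ln (ln (real N)) \<and> 1 \<le> d N \<and> b N > 0"
    using \<zeta>d' \<zeta>1 ev db
  proof eventually_elim
    case (elim N)
    have "1 * 1 \<le> \<zeta> N * ln (ln (real N))" using elim by (intro mult_mono) auto
    moreover from this have "1 \<le> b N * ln (real N)" using elim by linarith
    then have "0 < b N * ln (real N)" by linarith
    then have "b N > 0" using elim by (simp add: zero_less_mult_iff)
    ultimately show ?case using elim by linarith
  qed
  {
    fix \<alpha> \<beta> :: "nat \<Rightarrow> real"
    assume \<alpha>\<beta>: "\<forall>\<^sub>F N in sequentially. 2 \<le> \<alpha> N \<and> \<alpha> N < \<beta> N \<and> \<beta> N \<le> \<alpha>_max (b N)"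
      and gap: "\<forall>\<^sub>F N in sequentially. \<beta> N - \<alpha> N \<ge> C * (\<zeta> N * ln (ln (real N)) / (d N * ln (\<alpha> N)))"
    have gap': "\<forall>\<^sub>F N in sequentially. \<zeta> N * ln (ln (real N)) / (d N * ln (\<alpha> N)) \<le> \<beta> N - \<alpha> N"
      using gap \<alpha>\<beta> pos
    proof eventually_elim
      case (elim N)
      have "0 \<le> \<zeta> N * ln (ln (real N)) / (d N * ln (\<alpha> N))" using elim by simp
      then have "1 * (\<zeta> N * ln (ln (real N)) / (d N * ln (\<alpha> N))) \<le> C * (\<zeta> N * ln (ln (real N)) / (d N * ln (\<alpha> N)))"
        using C by (intro mult_right_mono) auto
      then show ?case using elim by linarith
    qed
    show "whp (\<lambda>N. erdos_renyi N (d N / real N))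
            (\<lambda>N E. \<exists>\<epsilon>. \<bar>\<epsilon>\<bar> \<le> 1 * (\<zeta> N * ln (ln (real N)) / ln (real N)) \<and>
               real (card {x \<in> {1..N}. \<alpha> N \<le> norm_degree N (d N) E x \<and>
                                        norm_degree N (d N) E x \<le> \<beta> N})
                 = real N powr (\<theta> (b N) (\<alpha> N) + \<epsilon>))"
      unfolding mult_1 by (rule whp_count[OF db \<zeta> \<zeta>d' \<alpha>\<beta> gap']) (auto intro!: always_eventually)
  }
  {
    fix l \<delta> :: "nat \<Rightarrow> real"
    assume \<delta>: "\<forall>\<^sub>F N in sequentially. \<delta> N \<ge> C * (\<zeta> N * ln (ln (real N)) / d N)"
      and l: "\<forall>\<^sub>F N in sequentially. 2 + \<delta> N \<le> l N \<and> l N \<le> \<Lambda> (\<alpha>_max (b N))"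
    \<comment> \<open>Only \<open>\<Lambda>_inv l\<close>, not \<open>\<Lambda>_inv (l + \<delta>)\<close>, is known to lie below \<open>\<alpha>_max b\<close>; half of the window suffices.\<close>
    define \<alpha> \<beta> where "\<alpha> N = \<Lambda>_inv (l N - \<delta> N)" and "\<beta> N = \<Lambda>_inv (l N)" for N
    have \<delta>': "\<forall>\<^sub>F N in sequentially. \<zeta> N * ln (ln (real N)) / d N \<le> \<delta> N \<and> 0 < \<delta> N"
      using \<delta> pos
    proof eventually_elim
      case (elim N)
      have "0 < \<zeta> N * ln (ln (real N)) / d N" using elim by simp
      moreover from this have "1 * (\<zeta> N * ln (ln (real N)) / d N) \<le> C * (\<zeta> N * ln (ln (real N)) / d N)"
        using C by (intro mult_right_mono) auto
      ultimately show ?case using elim by linarith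
    qed
    have inv: "\<forall>\<^sub>F N in sequentially. 2 \<le> \<alpha> N \<and> \<Lambda> (\<alpha> N) = l N - \<delta> N \<and> 2 \<le> \<beta> N \<and> \<Lambda> (\<beta> N) = l N
        \<and> \<alpha> N < \<beta> N"
      using \<delta>' l
    proof eventually_elim
      case (elim N)
      then have 1: "2 \<le> \<alpha> N" "\<Lambda> (\<alpha> N) = l N - \<delta> N" "2 \<le> \<beta> N" "\<Lambda> (\<beta> N) = l N"
        using \<Lambda>_inv[of "l N - \<delta> N"] \<Lambda>_inv[of "l N"] by (auto simp: \<alpha>_def \<beta>_def)
      then show ?case using \<Lambda>_le_iff[of "\<beta> N" "\<alpha> N"] elim by auto
    qed
    have \<alpha>\<beta>: "\<forall>\<^sub>F N in sequentially. 2 \<le> \<alpha> N \<and> \<alpha> N < \<beta> N \<and> \<beta> N \<le> \<alpha>_max (b N)"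
      using inv l pos
    proof eventually_elim
      case (elim N)
      then show ?case using \<Lambda>_le_iff[of "\<beta> N" "\<alpha>_max (b N)"] \<alpha>_max_ge_2[of "b N"] by auto
    qed
    have gap: "\<forall>\<^sub>F N in sequentially. \<zeta> N * ln (ln (real N)) / (d N * ln (\<alpha> N)) \<le> \<beta> N - \<alpha> N"
      using inv \<delta>' pos
    proof eventually_elim
      case (elim N)
      have "ln 2 \<le> ln (\<alpha> N)" using elim by simp
      then have ln: "1 \<le> 2 * ln (\<alpha> N)" using ln2_ge_two_thirds by linarith
      have "\<zeta> N * ln (ln (real N)) / (d N * ln (\<alpha> N)) = \<zeta> N * ln (ln (real N)) / d N / ln (\<alpha> N)"
        by simp
      also have "\<dots> \<le> \<delta> N / ln (\<alpha> N)"
        using elim ln by (intro divide_right_mono) auto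
      also have "\<dots> \<le> 2 * \<delta> N"
        using mult_right_mono[OF ln, of "\<delta> N"] elim ln by (simp add: divide_le_eq mult_ac)
      also have "\<dots> \<le> \<beta> N - \<alpha> N"
        using \<Lambda>_increment(2)[of "\<alpha> N" "\<beta> N"] elim by simp
      finally show ?case .
    qed
    have "\<forall>\<^sub>F N in sequentially. \<forall>E. E \<subseteq> vertex_pairs N \<longrightarrow>
        {x \<in> {1..N}. \<alpha> N \<le> norm_degree N (d N) E x \<and> norm_degree N (d N) E x \<le> \<beta> N}
          \<subseteq> \<W> N (d N) E (l N) (\<delta> N) \<and>
        \<W> N (d N) E (l N) (\<delta> N) \<subseteq> {x \<in> {1..N}. \<alpha> N \<le> norm_degree N (d N) E x}"
      using inv \<delta>'
    proof eventually_elim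
      case (elim N)
      have "2 \<le> r \<and> \<bar>\<Lambda> r - l N\<bar> \<le> \<delta> N" if "\<alpha> N \<le> r" "r \<le> \<beta> N" for r
        using that elim \<Lambda>_le_iff[of "\<alpha> N" r] \<Lambda>_le_iff[of r "\<beta> N"] by auto
      moreover have "\<alpha> N \<le> r" if "2 \<le> r" "\<bar>\<Lambda> r - l N\<bar> \<le> \<delta> N" for r
        using that elim \<Lambda>_le_iff[of "\<alpha> N" r] by auto
      ultimately show ?case by (auto simp: \<W>_def)
    qed
    then show "whp (\<lambda>N. erdos_renyi N (d N / real N))
            (\<lambda>N E. \<exists>\<epsilon>. \<bar>\<epsilon>\<bar> \<le> 1 * (\<zeta> N * ln (ln (real N)) / ln (real N)) \<and>
               real (card (\<W> N (d N) E (l N) (\<delta> N)))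
                 = real N powr (\<theta> (b N) (\<Lambda>_inv (l N - \<delta> N)) + \<epsilon>))"
      unfolding mult_1 \<alpha>_def[symmetric] by (rule whp_count[OF db \<zeta> \<zeta>d' \<alpha>\<beta> gap])
  }
qed

end
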